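(* Let $\alpha>2$ be a real number and let $(c_{n,k})$ be the coefficients of the Boţ–Nguyen acceleration with parameter $\alpha$ (defined by the recursion in the context). Then the following hold: (i) $\displaystyle\sum_{k=0}^{n}c_{n,k}=1$ for every $n\in\mathbb{N}$. (ii) $c_{n,k}>0$ for every $n\in\mathbb{N}$ and every $k\in\{0,1,\ldots,n\}$. (iii) $\displaystyle\lim_{n\to\infty}c_{n,k}=0$ for every $k\in\mathbb{N}$. Consequently, for each $n$ the numbers $c_{n,0},\ldots,c_{n,n}$ form a discrete probability distribution, and the Boţ–Nguyen iteration $(x_n)_{n\in\mathbb{N}}$ of any linear nonexpansive operator $T\colon X\to X$ on a real Hilbert space $X$ with starting point $x_0\in X$ is the weighted mean iteration $x_{n+1}=\sum_{k=0}^{n}c_{n,k}T^kx_0$ ($n\in\mathbb{N}$) induced by this distribution.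
   Context: $\mathbb{N}=\{0,1,2,\ldots\}$. Nonexpansive means $\|Tx-Ty\|\le\|x-y\|$ for all $x,y\in X$. Boţ–Nguyen iteration: given $\alpha>2$, $T$ and $x_0$, set $x_1:=x_0$ and, for every $n\ge 1$, $$x_{n+1}:=\Big(1-\frac{\alpha}{2(n+\alpha)}\Big)x_n+\frac{\alpha}{2(n+\alpha)}Tx_n+\frac{n}{n+\alpha}(Tx_n-Tx_{n-1}).$$ Coefficients: expanding this iteration for linear $T$ as $x_{n+1}=\sum_{k}c_{n,k}T^kx_0$ leads to the following real numbers $c_{n,k}$ ($n,k\in\mathbb{Z}$). By convention $c_{n,k}:=0$ if $n<0$ or $k<0$ or $k>n$. Moreover $$c_{0,0}=1,\quad c_{1,0}=\frac{2+\alpha}{2(1+\alpha)},\quad c_{1,1}=\frac{\alpha}{2(1+\alpha)},$$ and for all $n\ge 2$ and $k\in\{0,\ldots,n\}$, $$c_{n,k}=\frac{2n+\alpha}{2(n+\alpha)}c_{n-1,k}+\frac{2n+\alpha}{2(n+\alpha)}c_{n-1,k-1}-\frac{n}{n+\alpha}c_{n-2,k-1}.$$ *)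

theory Defs
  imports "HOL-Probability.Probability"
begin

text \<open>The value of the sequence at index n + 2 uses the iteration formula for the
  index m = n + 1, so that m ranges over all integers at least 1.\<close>

fun bot_nguyen :: "real \<Rightarrow> ('a::real_vector \<Rightarrow> 'a) \<Rightarrow> 'a \<Rightarrow> nat \<Rightarrow> 'a" where
  "bot_nguyen \<alpha> T x0 0 = x0"
| "bot_nguyen \<alpha> T x0 (Suc 0) = x0"
| "bot_nguyen \<alpha> T x0 (Suc (Suc n)) =
    (let m = real (Suc n); x = bot_nguyen \<alpha> T x0 (Suc n); x' = bot_nguyen \<alpha> T x0 n in
      (1 - \<alpha> / (2 * (m + \<alpha>))) *\<^sub>R x + (\<alpha> / (2 * (m + \<alpha>))) *\<^sub>R T x
      + (m / (m + \<alpha>)) *\<^sub>R (T x - T x'))"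

text \<open>Both indices are integers, because the recursion refers to the entries with k = -1 and
  k = n + 1, which vanish by convention.\<close>

function bot_nguyen_coeff :: "real \<Rightarrow> int \<Rightarrow> int \<Rightarrow> real" where
  "bot_nguyen_coeff \<alpha> n k =
    (if n < 0 \<or> k < 0 \<or> k > n then 0
     else if n = 0 then 1
     else if n = 1 then
       (if k = 0 then (2 + \<alpha>) / (2 * (1 + \<alpha>)) else \<alpha> / (2 * (1 + \<alpha>)))
     else
       (2 * of_int n + \<alpha>) / (2 * (of_int n + \<alpha>)) * bot_nguyen_coeff \<alpha> (n - 1) k
       + (2 * of_int n + \<alpha>) / (2 * (of_int n + \<alpha>)) * bot_nguyen_coeff \<alpha> (n - 1) (k - 1)
       - of_int n / (of_int n + \<alpha>) * bot_nguyen_coeff \<alpha> (n - 2) (k - 1))"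
  by pat_completeness auto
termination
  by (relation "Wellfounded.measure (\<lambda>(\<alpha>, n, k). nat n)") auto

text \<open>The unconditional equation makes the simplifier loop.\<close>

declare bot_nguyen_coeff.simps [simp del]

definition nonexpansive :: "('a::real_normed_vector \<Rightarrow> 'a) \<Rightarrow> bool" where
  "nonexpansive T \<longleftrightarrow> (\<forall>x y. norm (T x - T y) \<le> norm (x - y))"

end

theory Submission
  imports Defs
begin

text \<open>
  Write \<open>c\<^sub>n(t)\<close> for the polynomial with coefficients \<open>c\<^sub>n\<^sub>,\<^sub>k\<close> and put \<open>\<lambda> = \<alpha> / 2\<close>. The defining
  recursion is
  \<open>(n + \<alpha>) c\<^sub>n = (n + \<lambda>) (1 + t) c\<^sub>n\<^sub>-\<^sub>1 - n t c\<^sub>n\<^sub>-\<^sub>2\<close>. Evaluated at \<open>t = 1\<close> it gives (i), and with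
  \<open>t\<close> replaced by \<open>T\<close> it is the iteration itself; both are instances of one identity for weighted
  sums (\<open>sum_coeff_recursion\<close>).

  The negative last term hides the positivity (ii). It becomes visible from the generating
  function: if \<open>(n + 1)! / ((\<alpha> + 1) \<dots> (\<alpha> + n))\<close> is divided out of \<open>c\<^sub>n\<close> and \<open>K(z)\<close> is the sum
  of the resulting polynomials times \<open>z\<^sup>n\<^sup>+\<^sup>1\<close>, the three-term recursion with its initial values
  \<open>c\<^sub>0\<close>, \<open>c\<^sub>1\<close> is equivalent to \<open>K(0) = 0\<close> and
  \<open>K' = 1 / (1 - z) + \<lambda> K (1 / (1 - z) + t / (1 - t z))\<close>,
  whose right-hand side has only nonnegative coefficients. Keeping track of the part
  \<open>\<lambda> K t / (1 - t z)\<close>, rescaled to match \<open>c\<^sub>n\<close>, turns this differential equation into a first-order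
  recursion in \<open>n\<close> (\<open>coeff_carry_recursion_Suc\<close>) with an auxiliary array \<open>carry\<close> satisfying
  \<open>0 \<le> carry \<le> (n + 1) c\<^sub>n\<close>, and positivity follows by induction.

  The same first-order recursion yields (iii) by induction on \<open>k\<close>. Once column \<open>k - 1\<close> of both arrays
  tends to 0, column \<open>k\<close> of \<open>c\<close> satisfies
  \<open>(n + 1 + 2 \<lambda>) c\<^sub>n\<^sub>+\<^sub>1 \<le> (n + 1 + \<lambda>) c\<^sub>n + o(1)\<close>. Since \<open>\<lambda> \<ge> 1\<close>, the sequence
  \<open>(n + 1 + \<lambda>) c\<^sub>n\<close> then has increments at most \<open>o(1)\<close>, so \<open>c\<^sub>n\<close> tends to 0.
\<close>

section \<open>The coefficient recursion over the natural numbers\<close>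

abbreviation coeff_nat :: "real \<Rightarrow> nat \<Rightarrow> nat \<Rightarrow> real" where
  "coeff_nat \<alpha> n k \<equiv> bot_nguyen_coeff \<alpha> (int n) (int k)"

lemma coeff_eq_0: "n < k \<Longrightarrow> coeff_nat \<alpha> n k = 0"
  by (subst bot_nguyen_coeff.simps) simp

lemma coeff_0: "coeff_nat \<alpha> 0 k = of_bool (k = 0)"
  by (subst bot_nguyen_coeff.simps) simp

lemma coeff_1_0: "coeff_nat \<alpha> (Suc 0) 0 = (2 + \<alpha>) / (2 * (1 + \<alpha>))"
  by (subst bot_nguyen_coeff.simps) simp

lemma coeff_1_1: "coeff_nat \<alpha> (Suc 0) (Suc 0) = \<alpha> / (2 * (1 + \<alpha>))"
  by (subst bot_nguyen_coeff.simps) simp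

lemma coeff_neg: "k < 0 \<Longrightarrow> bot_nguyen_coeff \<alpha> n k = 0"
  by (subst bot_nguyen_coeff.simps) simp

lemma coeff_recursion_0:
  "coeff_nat \<alpha> (n + 2) 0 = (2 * real (n + 2) + \<alpha>) / (2 * (real (n + 2) + \<alpha>)) * coeff_nat \<alpha> (n + 1) 0"
  by (subst bot_nguyen_coeff.simps) (simp add: coeff_neg algebra_simps)

lemma coeff_recursion_Suc:
  "coeff_nat \<alpha> (n + 2) (Suc k) =
     (2 * real (n + 2) + \<alpha>) / (2 * (real (n + 2) + \<alpha>)) * (coeff_nat \<alpha> (n + 1) (Suc k) + coeff_nat \<alpha> (n + 1) k)
     - real (n + 2) / (real (n + 2) + \<alpha>) * coeff_nat \<alpha> n k"
proof (cases "k \<le> n + 1")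
  case True
  then show ?thesis
    by (subst bot_nguyen_coeff.simps) (simp add: distrib_left add.commute)
next
  case False
  then show ?thesis by (simp add: coeff_eq_0 del: of_nat_Suc of_nat_add)
qed

section \<open>Weighted sums of a row\<close>

text \<open>Taking \<open>v = (\<lambda>_. 1)\<close> this is the evaluation of the polynomial recursion at 1, and taking the
  orbit of a linear operator for \<open>v\<close> it is the iteration.\<close>

lemma sum_coeff_recursion:
  fixes v :: "nat \<Rightarrow> 'a::real_vector"
  shows "(\<Sum>k\<le>n + 2. coeff_nat \<alpha> (n + 2) k *\<^sub>R v k) =
    ((2 * real (n + 2) + \<alpha>) / (2 * (real (n + 2) + \<alpha>))) *\<^sub>R
      ((\<Sum>k\<le>n + 1. coeff_nat \<alpha> (n + 1) k *\<^sub>R v k) + (\<Sum>k\<le>n + 1. coeff_nat \<alpha> (n + 1) k *\<^sub>R v (Suc k)))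
    - (real (n + 2) / (real (n + 2) + \<alpha>)) *\<^sub>R (\<Sum>k\<le>n. coeff_nat \<alpha> n k *\<^sub>R v (Suc k))"
proof -
  define A B where "A = (2 * real (n + 2) + \<alpha>) / (2 * (real (n + 2) + \<alpha>))"
    and "B = real (n + 2) / (real (n + 2) + \<alpha>)"
  let ?c = "coeff_nat \<alpha>"
  have rec0: "?c (n + 2) 0 = A * ?c (n + 1) 0"
    unfolding A_def by (rule coeff_recursion_0)
  have rec: "?c (n + 2) (Suc k) = A * (?c (n + 1) (Suc k) + ?c (n + 1) k) - B * ?c n k" for k
    unfolding A_def B_def by (rule coeff_recursion_Suc)
  have "(\<Sum>k\<le>n + 2. ?c (n + 2) k *\<^sub>R v k)
      = ?c (n + 2) 0 *\<^sub>R v 0 + (\<Sum>k\<le>n + 1. ?c (n + 2) (Suc k) *\<^sub>R v (Suc k))"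
    using sum.atMost_Suc_shift[of "\<lambda>k. ?c (n + 2) k *\<^sub>R v k" "n + 1"] by simp
  also have "\<dots> = A *\<^sub>R (?c (n + 1) 0 *\<^sub>R v 0 + (\<Sum>k\<le>n + 1. ?c (n + 1) (Suc k) *\<^sub>R v (Suc k)))
      + A *\<^sub>R (\<Sum>k\<le>n + 1. ?c (n + 1) k *\<^sub>R v (Suc k)) - B *\<^sub>R (\<Sum>k\<le>n + 1. ?c n k *\<^sub>R v (Suc k))"
    unfolding rec0 rec
    by (simp add: algebra_simps sum.distrib sum_subtractf scaleR_sum_right del: sum.atMost_Suc)
  also have "?c (n + 1) 0 *\<^sub>R v 0 + (\<Sum>k\<le>n + 1. ?c (n + 1) (Suc k) *\<^sub>R v (Suc k))
      = (\<Sum>k\<le>n + 2. ?c (n + 1) k *\<^sub>R v k)"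
    using sum.atMost_Suc_shift[of "\<lambda>k. ?c (n + 1) k *\<^sub>R v k" "n + 1"] by simp
  also have "\<dots> = (\<Sum>k\<le>n + 1. ?c (n + 1) k *\<^sub>R v k)"
    using coeff_eq_0[of "n + 1" "n + 2" \<alpha>] by simp
  also have "(\<Sum>k\<le>n + 1. ?c n k *\<^sub>R v (Suc k)) = (\<Sum>k\<le>n. ?c n k *\<^sub>R v (Suc k))"
    using coeff_eq_0[of n "n + 1" \<alpha>] by simp
  finally show ?thesis
    unfolding A_def B_def scaleR_add_right .
qed

lemma sum_coeff_eq_1:
  assumes "\<alpha> > 0"
  shows "(\<Sum>k\<le>n. coeff_nat \<alpha> n k) = 1"
proof (induction n rule: induct_nat_012)
  case 0
  then show ?case by (simp add: coeff_0[where k=0, simplified])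
next
  case 1
  have "(\<Sum>k\<le>Suc 0. coeff_nat \<alpha> (Suc 0) k) = coeff_nat \<alpha> (Suc 0) 0 + coeff_nat \<alpha> (Suc 0) (Suc 0)"
    by simp
  also have "\<dots> = 1"
    unfolding coeff_1_0 coeff_1_1 add_divide_distrib[symmetric] using assms by simp
  finally show ?case .
next
  case (ge2 n)
  define m where "m = real (n + 2)"
  have "m + \<alpha> > 0" using assms by (simp add: m_def)
  then have "(2 * m + \<alpha>) / (2 * (m + \<alpha>)) * (1 + 1) - m / (m + \<alpha>) = 1"
    by (simp add: divide_simps) (simp add: algebra_simps)
  then show ?case
    using sum_coeff_recursion[where n=n and \<alpha>=\<alpha> and v="\<lambda>_. 1 :: real", folded m_def] ge2
    by (simp del: sum.atMost_Suc)
qed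

lemma bot_nguyen_eq_weighted_mean:
  fixes T :: "'a::real_vector \<Rightarrow> 'a"
  assumes "\<alpha> > 0" and T: "linear T"
  shows "bot_nguyen \<alpha> T x0 (n + 1) = (\<Sum>k\<le>n. coeff_nat \<alpha> n k *\<^sub>R (T ^^ k) x0)"
proof (induction n rule: induct_nat_012)
  case 0
  then show ?case by (simp add: coeff_0[where k=0, simplified])
next
  case 1
  have "bot_nguyen \<alpha> T x0 (Suc 0 + 1) = (1 - \<alpha> / (2 * (1 + \<alpha>))) *\<^sub>R x0 + (\<alpha> / (2 * (1 + \<alpha>))) *\<^sub>R T x0"
    by (simp add: Let_def)
  also have "1 - \<alpha> / (2 * (1 + \<alpha>)) = coeff_nat \<alpha> (Suc 0) 0"
    using assms unfolding coeff_1_0 by (simp add: field_simps)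
  also have "\<alpha> / (2 * (1 + \<alpha>)) = coeff_nat \<alpha> (Suc 0) (Suc 0)"
    unfolding coeff_1_1 ..
  finally show ?case by simp
next
  case (ge2 n)
  define m where "m = real (n + 2)"
  have T_row: "T (\<Sum>k\<le>j. coeff_nat \<alpha> j k *\<^sub>R (T ^^ k) x0)
      = (\<Sum>k\<le>j. coeff_nat \<alpha> j k *\<^sub>R (T ^^ Suc k) x0)" for j
    by (simp add: linear_sum[OF T] linear_scale[OF T])
  let ?x = "bot_nguyen \<alpha> T x0 (n + 2)" and ?x' = "bot_nguyen \<alpha> T x0 (n + 1)"
  have "m + \<alpha> > 0" using assms by (simp add: m_def)
  then have A: "1 - \<alpha> / (2 * (m + \<alpha>)) = (2 * m + \<alpha>) / (2 * (m + \<alpha>))"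
    "(2 * m + \<alpha>) / (2 * (m + \<alpha>)) = \<alpha> / (2 * (m + \<alpha>)) + m / (m + \<alpha>)"
    by (simp_all add: divide_simps) (simp_all add: algebra_simps)
  have x: "?x = (\<Sum>k\<le>n + 1. coeff_nat \<alpha> (n + 1) k *\<^sub>R (T ^^ k) x0)"
    and x': "?x' = (\<Sum>k\<le>n. coeff_nat \<alpha> n k *\<^sub>R (T ^^ k) x0)"
    using ge2 by (simp_all del: sum.atMost_Suc bot_nguyen.simps)
  have "bot_nguyen \<alpha> T x0 (n + 3) = (1 - \<alpha> / (2 * (m + \<alpha>))) *\<^sub>R ?x + (\<alpha> / (2 * (m + \<alpha>))) *\<^sub>R T ?x
      + (m / (m + \<alpha>)) *\<^sub>R (T ?x - T ?x')"
    by (simp add: m_def numeral_3_eq_3 Let_def)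
  also have "\<dots> = ((2 * m + \<alpha>) / (2 * (m + \<alpha>))) *\<^sub>R ?x
      + (\<alpha> / (2 * (m + \<alpha>)) + m / (m + \<alpha>)) *\<^sub>R T ?x - (m / (m + \<alpha>)) *\<^sub>R T ?x'"
    unfolding A(1) by (simp add: scaleR_add_left scaleR_diff_right)
  also have "\<dots> = ((2 * m + \<alpha>) / (2 * (m + \<alpha>))) *\<^sub>R (?x + T ?x) - (m / (m + \<alpha>)) *\<^sub>R T ?x'"
    unfolding A(2)[symmetric] by (simp add: scaleR_add_right)
  also have "\<dots> = (\<Sum>k\<le>n + 2. coeff_nat \<alpha> (n + 2) k *\<^sub>R (T ^^ k) x0)"
    unfolding sum_coeff_recursion x x' T_row m_def ..
  finally show ?case
    by (simp add: numeral_3_eq_3 del: bot_nguyen.simps sum.atMost_Suc)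
qed

section \<open>Positivity\<close>

lemma coeff_recursion_Suc_mult:
  assumes "\<alpha> > 0"
  shows "(real (n + 2) + \<alpha>) * coeff_nat \<alpha> (n + 2) (Suc k) =
     (real (n + 2) + \<alpha> / 2) * (coeff_nat \<alpha> (n + 1) (Suc k) + coeff_nat \<alpha> (n + 1) k)
     - real (n + 2) * coeff_nat \<alpha> n k"
proof -
  define D where "D = real (n + 2) + \<alpha>"
  have "D \<noteq> 0" using assms by (simp add: D_def)
  then have "D * ((2 * real (n + 2) + \<alpha>) / (2 * D)) = real (n + 2) + \<alpha> / 2"
    and "D * (real (n + 2) / D) = real (n + 2)"
    by (simp_all add: field_simps)
  then show ?thesis
    unfolding coeff_recursion_Suc D_def[symmetric] right_diff_distrib mult.assoc[symmetric]
    by (simp only:)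
qed

text \<open>In the notation of the introduction, row \<open>n\<close> is the coefficient of \<open>z\<^sup>n\<close> in
  \<open>\<lambda> K t / (1 - t z)\<close>, multiplied by the factor that was divided out of \<open>c\<^sub>n\<close>; the fraction
  below is the quotient of two consecutive such factors.\<close>

fun carry :: "real \<Rightarrow> nat \<Rightarrow> nat \<Rightarrow> real" where
  "carry \<alpha> 0 k = 0"
| "carry \<alpha> (Suc n) 0 = 0"
| "carry \<alpha> (Suc n) (Suc k) =
     (real n + 2) / (real n + 1 + \<alpha>) * (carry \<alpha> n k + \<alpha> / 2 * coeff_nat \<alpha> n k)"

lemma carry_0_right [simp]: "carry \<alpha> n 0 = 0"
  by (cases n) simp_all

lemma coeff_carry_recursion_0:
  assumes "\<alpha> > 0"
  shows "(real n + 1 + \<alpha>) * coeff_nat \<alpha> (Suc n) 0 = (real n + 1 + \<alpha> / 2) * coeff_nat \<alpha> n 0"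
proof (cases n)
  case 0
  then show ?thesis
    using assms coeff_0[of \<alpha> 0] coeff_1_0[of \<alpha>] by (simp add: field_simps)
next
  case (Suc m)
  then show ?thesis
    using assms coeff_recursion_0[of \<alpha> m] by (simp add: field_simps)
qed

text \<open>Eliminating the carry between two consecutive instances of this recursion gives back the
  three-term recursion; the induction runs that elimination in reverse.\<close>

lemma coeff_carry_recursion_Suc:
  assumes "\<alpha> > 0"
  shows "(real n + 1 + \<alpha>) * coeff_nat \<alpha> (Suc n) (Suc k) =
     (real n + 1 + \<alpha> / 2) * coeff_nat \<alpha> n (Suc k) + \<alpha> / 2 * coeff_nat \<alpha> n k
     - carry \<alpha> n (Suc k) + carry \<alpha> n k"
proof (induction n arbitrary: k)
  case 0
  show ?case
  proof (cases k)
    case 0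
    then show ?thesis
      using assms coeff_0[of \<alpha> 0] coeff_0[of \<alpha> 1] coeff_1_1[of \<alpha>] by (simp add: field_simps)
  next
    case (Suc j)
    then show ?thesis
      using coeff_0[of \<alpha> k] coeff_0[of \<alpha> "Suc k"] coeff_eq_0[of "Suc 0" "Suc k" \<alpha>]
      by (simp del: of_nat_Suc)
  qed
next
  case (Suc n)
  define q where "q = real n + 1 + \<alpha>"
  let ?c = "coeff_nat \<alpha>" and ?w = "carry \<alpha>"
  have q: "q > 0" using assms by (simp add: q_def add_pos_nonneg)
  \<comment> \<open>Both carries of the new row are expressed through row \<open>n\<close>, the left one by solving the induction
    hypothesis for the terms of column \<open>k - 1\<close>; in their difference the carry of row \<open>n\<close> cancels.\<close>
  have carry_left: "q * ?w (Suc n) k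
      = (real n + 2) * (q * ?c (Suc n) k - q * ?c n k + ?w n k + \<alpha> / 2 * ?c n k)"
  proof (cases k)
    case 0
    have "q * ?c (Suc n) 0 - q * ?c n 0 + \<alpha> / 2 * ?c n 0 = 0"
      using coeff_carry_recursion_0[OF assms, of n] by (simp add: q_def algebra_simps)
    then show ?thesis using 0 by simp
  next
    case (Suc j)
    have "q * ?w (Suc n) (Suc j) = (real n + 2) * (?w n j + \<alpha> / 2 * ?c n j)"
      using q by (simp add: q_def)
    also have "?w n j + \<alpha> / 2 * ?c n j
        = q * ?c (Suc n) (Suc j) - q * ?c n (Suc j) + ?w n (Suc j) + \<alpha> / 2 * ?c n (Suc j)"
      using Suc.IH[of j] by (simp add: q_def algebra_simps)
    finally show ?thesis using Suc by simp
  qed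
  have "q * ?w (Suc n) (Suc k) = (real n + 2) * (?w n k + \<alpha> / 2 * ?c n k)"
    using q by (simp add: q_def)
  then have "q * (?w (Suc n) (Suc k) - ?w (Suc n) k) = q * ((real n + 2) * (?c n k - ?c (Suc n) k))"
    unfolding right_diff_distrib carry_left by (simp add: algebra_simps)
  then have "?w (Suc n) (Suc k) - ?w (Suc n) k = (real n + 2) * (?c n k - ?c (Suc n) k)"
    using q by simp
  moreover have "(q + 1) * ?c (Suc (Suc n)) (Suc k) =
      (real n + 2 + \<alpha> / 2) * (?c (Suc n) (Suc k) + ?c (Suc n) k) - (real n + 2) * ?c n k"
    using coeff_recursion_Suc_mult[OF assms, of n k]
    by (simp add: q_def add.commute add.left_commute)
  ultimately show ?case
    by (simp add: q_def algebra_simps)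
qed

text \<open>The upper bound on the carry says that \<open>(n + 1) c\<^sub>n\<close> minus the carry, the part of \<open>K'\<close> coming
  from \<open>(1 + \<lambda> K) / (1 - z)\<close>, is nonnegative as well.\<close>

lemma coeff_nonneg_and_carry_bounds:
  assumes "\<alpha> > 0"
  shows "0 \<le> coeff_nat \<alpha> n k \<and> 0 \<le> carry \<alpha> n k \<and> carry \<alpha> n k \<le> (real n + 1) * coeff_nat \<alpha> n k"
proof (induction n arbitrary: k)
  case 0
  then show ?case using coeff_0[of \<alpha> k] by simp
next
  case (Suc n)
  have q: "real n + 1 + \<alpha> > 0" using assms by (simp add: add_pos_nonneg)
  show ?case
  proof (cases k)
    case 0
    have "0 \<le> (real n + 1 + \<alpha>) * coeff_nat \<alpha> (Suc n) 0"
      unfolding coeff_carry_recursion_0[OF assms] using Suc.IH[of 0] assms by simp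
    then have "0 \<le> coeff_nat \<alpha> (Suc n) 0"
      using q by (simp add: zero_le_mult_iff)
    then show ?thesis using 0 by simp
  next
    case k: (Suc j)
    have lam: "0 \<le> \<alpha> / 2 * coeff_nat \<alpha> n i" for i
      using Suc.IH[of i] assms by simp
    have le: "carry \<alpha> n j + \<alpha> / 2 * coeff_nat \<alpha> n j \<le> (real n + 1 + \<alpha>) * coeff_nat \<alpha> (Suc n) (Suc j)"
      unfolding coeff_carry_recursion_Suc[OF assms]
      using Suc.IH[of "Suc j"] lam[of "Suc j"] by (simp add: algebra_simps)
    have carry0: "0 \<le> carry \<alpha> n j + \<alpha> / 2 * coeff_nat \<alpha> n j"
      using Suc.IH[of j] lam[of j] by simp
    have "0 \<le> coeff_nat \<alpha> (Suc n) (Suc j)"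
      using order_trans[OF carry0 le] q by (simp add: zero_le_mult_iff)
    moreover have "0 \<le> carry \<alpha> (Suc n) (Suc j)"
      using carry0 q by simp
    moreover have "carry \<alpha> (Suc n) (Suc j) \<le> (real (Suc n) + 1) * coeff_nat \<alpha> (Suc n) (Suc j)"
      using mult_left_mono[OF le, of "(real n + 2) / (real n + 1 + \<alpha>)"] q by (simp add: add.commute)
    ultimately show ?thesis using k by simp
  qed
qed

lemma coeff_pos:
  assumes "\<alpha> > 0" "k \<le> n"
  shows "coeff_nat \<alpha> n k > 0"
  using assms(2)
proof (induction n arbitrary: k)
  case 0
  then show ?case using coeff_0[of \<alpha> 0] by simp
next
  case (Suc n)
  note bounds = coeff_nonneg_and_carry_bounds[OF assms(1)]
  have q: "real n + 1 + \<alpha> > 0" using assms by (simp add: add_pos_nonneg)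
  have "0 < (real n + 1 + \<alpha>) * coeff_nat \<alpha> (Suc n) k"
  proof (cases k)
    case 0
    have "coeff_nat \<alpha> n 0 > 0" by (rule Suc.IH) simp
    then show ?thesis
      unfolding 0 coeff_carry_recursion_0[OF assms(1)] using assms by (simp add: add_pos_nonneg)
  next
    case (Suc j)
    have "0 < \<alpha> / 2 * coeff_nat \<alpha> n j"
      using Suc.IH[of j] Suc Suc.prems assms by simp
    moreover have "0 \<le> \<alpha> / 2 * coeff_nat \<alpha> n (Suc j)"
      using bounds[of n "Suc j"] assms by simp
    ultimately show ?thesis
      unfolding Suc coeff_carry_recursion_Suc[OF assms(1)]
      using bounds[of n j] bounds[of n "Suc j"] by (simp add: algebra_simps)
  qed
  then show ?case using q by (simp add: zero_less_mult_iff)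
qed

section \<open>Decay of the columns\<close>

text \<open>The sequence \<open>(n + s) a\<^sub>n\<close> has increments at most \<open>e\<^sub>n\<close>, hence is eventually below
  every positive multiple of \<open>n\<close>.\<close>

lemma tendsto_0_of_telescoping_bound:
  fixes a e :: "nat \<Rightarrow> real"
  assumes "s > 0" and nonneg: "\<And>n. a n \<ge> 0"
    and step: "\<And>n. (real (Suc n) + s) * a (Suc n) \<le> (real n + s) * a n + e n"
    and e: "e \<longlonglongrightarrow> 0"
  shows "a \<longlonglongrightarrow> 0"
proof (rule LIMSEQ_I)
  fix \<epsilon> :: real
  assume "\<epsilon> > 0"
  then have "eventually (\<lambda>n. e n < \<epsilon> / 2) sequentially"
    using e by (intro order_tendstoD) auto
  then obtain N where N: "\<And>n. n \<ge> N \<Longrightarrow> e n < \<epsilon> / 2"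
    by (auto simp: eventually_sequentially)
  define M where "M = (real N + s) * a N"
  have growth: "(real n + s) * a n \<le> M + real n * (\<epsilon> / 2)" if "n \<ge> N" for n
    using that
  proof (induction n rule: dec_induct)
    case base
    then show ?case using \<open>\<epsilon> > 0\<close> by (simp add: M_def)
  next
    case (step n)
    then show ?case using assms(3)[of n] N[of n] by (simp add: algebra_simps add_divide_distrib)
  qed
  have "(\<lambda>n. M / (real n + s)) \<longlonglongrightarrow> 0"
    by real_asymp
  then have "eventually (\<lambda>n. M / (real n + s) < \<epsilon> / 2) sequentially"
    using \<open>\<epsilon> > 0\<close> by (intro order_tendstoD) auto
  then obtain N' where N': "\<And>n. n \<ge> N' \<Longrightarrow> M / (real n + s) < \<epsilon> / 2"
    by (auto simp: eventually_sequentially)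
  have "norm (a n - 0) < \<epsilon>" if "n \<ge> max N N'" for n
  proof -
    have pos: "real n + s > 0" using \<open>s > 0\<close> by (simp add: add_nonneg_pos)
    have "M < \<epsilon> / 2 * (real n + s)"
      using N'[of n] that pos by (simp add: pos_divide_less_eq)
    moreover have "real n * (\<epsilon> / 2) \<le> \<epsilon> / 2 * (real n + s)"
      using \<open>\<epsilon> > 0\<close> \<open>s > 0\<close> by (simp add: algebra_simps)
    ultimately have "(real n + s) * a n < (real n + s) * \<epsilon>"
      using growth[of n] that by (simp add: algebra_simps)
    then show ?thesis using nonneg[of n] pos by simp
  qed
  then show "\<exists>no. \<forall>n\<ge>no. norm (a n - 0) < \<epsilon>" by blast
qed

text \<open>By its definition, column \<open>k + 1\<close> of the carry is a combination of column \<open>k\<close> of both arrays,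
  one row earlier, with bounded factors. For the coefficients, dropping the subtracted carry from
  the first-order recursion leaves the telescoping bound with \<open>s = 1 + \<alpha> / 2\<close>; here \<open>\<alpha> \<ge> 2\<close> enters as \<open>2 + \<alpha> / 2 \<le> 1 + \<alpha>\<close>.\<close>

lemma coeff_and_carry_tendsto_0:
  assumes "\<alpha> \<ge> 2"
  shows "(\<lambda>n. coeff_nat \<alpha> n k) \<longlonglongrightarrow> 0 \<and> (\<lambda>n. carry \<alpha> n k) \<longlonglongrightarrow> 0"
proof -
  have pos: "\<alpha> > 0" using assms by simp
  note bounds = coeff_nonneg_and_carry_bounds[OF pos]
  have factor: "(real (Suc n) + (1 + \<alpha> / 2)) * coeff_nat \<alpha> (Suc n) k
      \<le> (real n + 1 + \<alpha>) * coeff_nat \<alpha> (Suc n) k" for n k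
    using bounds[of "Suc n" k] assms by (intro mult_right_mono) auto
  show ?thesis
  proof (induction k)
    case 0
    have "(\<lambda>n. coeff_nat \<alpha> n 0) \<longlonglongrightarrow> 0"
    proof (rule tendsto_0_of_telescoping_bound)
      show "(real (Suc n) + (1 + \<alpha> / 2)) * coeff_nat \<alpha> (Suc n) 0
          \<le> (real n + (1 + \<alpha> / 2)) * coeff_nat \<alpha> n 0 + 0" for n
        using factor[of n 0] coeff_carry_recursion_0[OF pos, of n] by (simp add: algebra_simps)
    qed (use pos bounds[of _ 0] in auto)
    then show ?case by simp
  next
    case (Suc k)
    define e where "e n = carry \<alpha> n k + \<alpha> / 2 * coeff_nat \<alpha> n k" for n
    have e: "e \<longlonglongrightarrow> 0"
      unfolding e_def using Suc by (auto intro!: tendsto_eq_intros)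
    have "(\<lambda>n. coeff_nat \<alpha> n (Suc k)) \<longlonglongrightarrow> 0"
    proof (rule tendsto_0_of_telescoping_bound)
      show "(real (Suc n) + (1 + \<alpha> / 2)) * coeff_nat \<alpha> (Suc n) (Suc k)
          \<le> (real n + (1 + \<alpha> / 2)) * coeff_nat \<alpha> n (Suc k) + e n" for n
        using factor[of n "Suc k"] coeff_carry_recursion_Suc[OF pos, of n k] bounds[of n "Suc k"]
        by (simp add: e_def algebra_simps)
      show "0 \<le> coeff_nat \<alpha> n (Suc k)" for n
        using bounds[of n "Suc k"] by simp
    qed (use pos e in auto)
    moreover have "(\<lambda>n. carry \<alpha> n (Suc k)) \<longlonglongrightarrow> 0"
    proof -
      have "(\<lambda>n. (real n + 2) / (real n + 1 + \<alpha>)) \<longlonglongrightarrow> 1"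
        by real_asymp
      from tendsto_mult[OF this e] have "(\<lambda>n. carry \<alpha> (Suc n) (Suc k)) \<longlonglongrightarrow> 0"
        by (simp add: e_def)
      then show ?thesis by (rule LIMSEQ_imp_Suc)
    qed
    ultimately show ?case ..
  qed
qed

section \<open>Conclusion\<close>

lemma ex_pmf_of_finite_weights:
  fixes f :: "'a \<Rightarrow> real"
  assumes "finite A" and "\<And>x. x \<in> A \<Longrightarrow> 0 \<le> f x" and "sum f A = 1"
  shows "\<exists>p. set_pmf p \<subseteq> A \<and> (\<forall>x\<in>A. pmf p x = f x)"
proof -
  define g where "g x = (if x \<in> A then f x else 0)" for x
  have g: "0 \<le> g x" for x using assms by (simp add: g_def)
  have "(\<integral>\<^sup>+ x. ennreal (g x) \<partial>count_space UNIV) = (\<Sum>x\<in>A. ennreal (g x))"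
    using assms(1) by (intro nn_integral_count_space') (auto simp: g_def)
  also have "\<dots> = 1"
    using assms g by (simp add: sum_ennreal g_def)
  finally have "pmf (embed_pmf g) x = g x" for x
    using g by (intro pmf_embed_pmf)
  then show ?thesis
    by (intro exI[of _ "embed_pmf g"]) (auto simp: set_pmf_eq g_def)
qed

theorem theorem4p4:
  fixes \<alpha> :: real
  assumes "\<alpha> > 2"
  shows "(\<forall>n::nat. (\<Sum>k=0..n. bot_nguyen_coeff \<alpha> (int n) (int k)) = 1)
    \<and> (\<forall>n::nat. \<forall>k\<in>{0..n}. bot_nguyen_coeff \<alpha> (int n) (int k) > 0)
    \<and> (\<forall>k::nat. (\<lambda>n::nat. bot_nguyen_coeff \<alpha> (int n) (int k)) \<longlonglongrightarrow> 0)
    \<and> (\<forall>n::nat. \<exists>p::nat pmf. set_pmf p \<subseteq> {0..n} \<and>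
          (\<forall>k\<in>{0..n}. pmf p k = bot_nguyen_coeff \<alpha> (int n) (int k)))
    \<and> (\<forall>(T :: 'a::{real_inner, complete_space} \<Rightarrow> 'a) x0. linear T \<and> nonexpansive T \<longrightarrow>
          (\<forall>n::nat. bot_nguyen \<alpha> T x0 (n + 1) =
            (\<Sum>k=0..n. bot_nguyen_coeff \<alpha> (int n) (int k) *\<^sub>R (T ^^ k) x0)))"
proof -
  have pos: "\<alpha> > 0" and ge: "\<alpha> \<ge> 2" using assms by simp_all
  have "\<exists>p::nat pmf. set_pmf p \<subseteq> {0..n} \<and> (\<forall>k\<in>{0..n}. pmf p k = coeff_nat \<alpha> n k)" for n
    using ex_pmf_of_finite_weights[of "{0..n}" "coeff_nat \<alpha> n"] sum_coeff_eq_1[OF pos, of n]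
      coeff_pos[OF pos, of _ n]
    by (simp add: atLeast0AtMost less_imp_le)
  then show ?thesis
    using sum_coeff_eq_1[OF pos] coeff_pos[OF pos] coeff_and_carry_tendsto_0[OF ge]
      bot_nguyen_eq_weighted_mean[OF pos]
    by (auto simp: atLeast0AtMost)
qed

end
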